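(* Let $k\in[0,1]$, let $\{\varphi_n(r)\}_{n=0}^\infty\in\mathcal F_{dec}$ and let $\Phi_1(r)=\sum_{n=1}^\infty\varphi_n(r)$. Let $R\in(0,1)$ be the minimal positive root of the equation $1=2(1+k)\Phi_1(x)$, and suppose that $1>2(1+k)\Phi_1(r)$ for all $r\in[0,R)$. Let $\psi$ be univalent and convex in $\mathbb D$, and let $f(z)=h(z)+\overline{g(z)}=\sum_{n=0}^\infty a_nz^n+\overline{\sum_{n=1}^\infty b_nz^n}$ be a harmonic mapping of $\mathbb D$, with $h,g$ analytic in $\mathbb D$, such that $|g'(z)|\le k|h'(z)|$ for all $z\in\mathbb D$ and $h\prec\psi$. Then $$\sum_{n=1}^\infty|a_n|\varphi_n(r)+\sum_{n=1}^\infty|b_n|\varphi_n(r)\le\operatorname{dist}(\psi(0),\partial\psi(\mathbb D))\quad\text{for all } r\in[0,R].$$ Moreover, if $1<2(1+k)\Phi_1(x)$ for all $x$ in some interval $(R,R+\epsilon)\subset(0,1)$ with $\epsilon>0$, then the number $R$ cannot be improved: for every $R'\in(R,1)$ there exist $\psi$ and $f=h+\overline g$ satisfying the hypotheses above (with the given $k$) and $r\in(R,R')$ such that $\sum_{n=1}^\infty|a_n|\varphi_n(r)+\sum_{n=1}^\infty|b_n|\varphi_n(r)>\operatorname{dist}(\psi(0),\partial\psi(\mathbb D))$.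
   Context: $\mathbb D=\{z\in\mathbb C:|z|<1\}$. $\mathcal F$ is the set of all sequences $\{\varphi_n(r)\}_{n=0}^\infty$ of nonnegative continuous functions on $[0,1)$ such that $\sum_{n=0}^\infty\varphi_n(r)$ converges locally uniformly with respect to $r\in[0,1)$. $\mathcal F_{dec}\subset\mathcal F$ is the subset of decreasing sequences, i.e. $\varphi_{n+1}(r)\le\varphi_n(r)$ for all $n\ge0$ and $r\in[0,1)$. A univalent analytic function $\psi$ in $\mathbb D$ is convex if $\psi(\mathbb D)$ is a convex domain. For analytic $h,\psi$ in $\mathbb D$, $h$ is subordinate to $\psi$ ($h\prec\psi$) if there is an analytic $\omega$ in $\mathbb D$ with $\omega(0)=0$, $|\omega(z)|<1$ and $h=\psi\circ\omega$. $\operatorname{dist}(w,\partial\Omega)$ is the Euclidean distance from $w$ to the boundary of $\Omega$. *)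

theory Defs
  imports "HOL-Complex_Analysis.Complex_Analysis"
begin

definition F_class :: "(nat \<Rightarrow> real \<Rightarrow> real) set" where
  "F_class = {\<phi>.
     (\<forall>n. continuous_on {0..<1} (\<phi> n)) \<and>
     (\<forall>n. \<forall>r\<in>{0..<1}. 0 \<le> \<phi> n r) \<and>
     (\<forall>x\<in>{0..<1}. \<exists>d>0.
        uniformly_convergent_on (ball x d \<inter> {0..<1}) (\<lambda>N r. \<Sum>n<N. \<phi> n r))}"

definition F_dec :: "(nat \<Rightarrow> real \<Rightarrow> real) set" where
  "F_dec = {\<phi> \<in> F_class. \<forall>n. \<forall>r\<in>{0..<1}. \<phi> (Suc n) r \<le> \<phi> n r}"

definition Phi1 :: "(nat \<Rightarrow> real \<Rightarrow> real) \<Rightarrow> real \<Rightarrow> real" where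
  "Phi1 \<phi> r = (\<Sum>n. \<phi> (Suc n) r)"

definition univalent_convex :: "(complex \<Rightarrow> complex) \<Rightarrow> bool" where
  "univalent_convex \<psi> \<longleftrightarrow>
     \<psi> holomorphic_on ball 0 1 \<and> inj_on \<psi> (ball 0 1) \<and> convex (\<psi> ` ball 0 1)"

definition subordinate :: "(complex \<Rightarrow> complex) \<Rightarrow> (complex \<Rightarrow> complex) \<Rightarrow> bool" where
  "subordinate h \<psi> \<longleftrightarrow>
     (\<exists>\<omega>. \<omega> holomorphic_on ball 0 1 \<and> \<omega> 0 = 0 \<and>
        (\<forall>z\<in>ball 0 1. norm (\<omega> z) < 1 \<and> h z = \<psi> (\<omega> z)))"

text \<open>
  A complex-valued function on the disc is harmonic iff it is a sum of a holomorphic and an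
  antiholomorphic function; the decomposition below, with \<open>g 0 = 0\<close>, is the canonical one.
  The value \<open>b 0\<close> plays no role.
\<close>

definition harmonic_decomp ::
  "(complex \<Rightarrow> complex) \<Rightarrow> (complex \<Rightarrow> complex) \<Rightarrow> (complex \<Rightarrow> complex) \<Rightarrow>
   (nat \<Rightarrow> complex) \<Rightarrow> (nat \<Rightarrow> complex) \<Rightarrow> bool" where
  "harmonic_decomp f h g a b \<longleftrightarrow>
     h holomorphic_on ball 0 1 \<and> g holomorphic_on ball 0 1 \<and>
     (\<forall>z\<in>ball 0 1. f z = h z + cnj (g z) \<and>
        (\<lambda>n. a n * z ^ n) sums h z \<and>
        (\<lambda>n. b (Suc n) * z ^ Suc n) sums g z)"

definition admissible ::
  "real \<Rightarrow> (complex \<Rightarrow> complex) \<Rightarrow> (complex \<Rightarrow> complex) \<Rightarrow> (complex \<Rightarrow> complex) \<Rightarrow>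
   (complex \<Rightarrow> complex) \<Rightarrow> (nat \<Rightarrow> complex) \<Rightarrow> (nat \<Rightarrow> complex) \<Rightarrow> bool" where
  "admissible k \<psi> f h g a b \<longleftrightarrow>
     univalent_convex \<psi> \<and> harmonic_decomp f h g a b \<and>
     (\<forall>z\<in>ball 0 1. norm (deriv g z) \<le> k * norm (deriv h z)) \<and>
     subordinate h \<psi>"

text \<open>
  By Liouville's theorem an injective holomorphic image of the disc is not the whole plane, so for
  univalent \<open>\<psi>\<close> the frontier is nonempty and \<open>infdist\<close> is the genuine distance.
\<close>

definition boundary_dist :: "(complex \<Rightarrow> complex) \<Rightarrow> real" where
  "boundary_dist \<psi> = infdist (\<psi> 0) (frontier (\<psi> ` ball 0 1))"

end

theory Submission
  imports Defs
begin

text \<open>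
  Write \<open>d\<close> for the distance from \<open>\<psi> 0\<close> to the boundary of the convex image. The inequality follows from
  \<open>\<Sum> \<bar>a\<^sub>n\<bar> \<phi>\<^sub>n(r) + \<Sum> \<bar>b\<^sub>n\<bar> \<phi>\<^sub>n(r) \<le> 2 (1 + k) \<Phi>\<^sub>1(r) d\<close>, which holds for all \<open>r\<close> in \<open>[0, 1)\<close>
  (\<open>weighted_coeff_sum_bound\<close>), because \<open>2 (1 + k) \<Phi>\<^sub>1(r) \<le> 1\<close> up to \<open>R\<close>. Its two sums have
  different reasons.

  The coefficients of \<open>h\<close> satisfy \<open>\<bar>a\<^sub>n\<bar> \<le> 2 d\<close> for \<open>n \<ge> 1\<close>. A convex domain lies in a half-plane
  whose edge is within \<open>d\<close> of \<open>\<psi> 0\<close>, so \<open>h\<close>, being subordinate to \<open>\<psi>\<close>, takes its values there, and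
  Caratheodory's estimate for functions with nonnegative real part applies
  (\<open>subordinate_convex_coeff_bound\<close>).

  The coefficients of \<open>g\<close> need not be bounded termwise by \<open>k \<bar>a\<^sub>n\<bar>\<close>. But \<open>g' = w h'\<close> with \<open>w\<close>
  holomorphic and bounded by \<open>k\<close>, and multiplication by \<open>w\<close> enlarges every partial sum of squares of
  coefficients at most by the factor \<open>k\<^sup>2\<close> (\<open>bounded_multiplier_partial_square_sums\<close>). So
  \<open>\<Sum> n\<^sup>2 \<bar>b\<^sub>n\<bar>\<^sup>2 \<le> k\<^sup>2 \<Sum> n\<^sup>2 \<bar>a\<^sub>n\<bar>\<^sup>2\<close> for all partial sums, hence also after insertion of the
  decreasing weights \<open>\<phi>\<^sub>n / n\<^sup>2\<close> (\<open>sum_mult_antimono_weights_mono\<close>). With \<open>\<bar>a\<^sub>n\<bar> \<le> 2 d\<close> and the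
  Cauchy--Schwarz inequality, \<open>\<Sum> \<bar>b\<^sub>n\<bar> \<phi>\<^sub>n \<le> 2 d k \<Phi>\<^sub>1\<close>.

  For sharpness, \<open>\<psi> = h = 1 / (1 - z)\<close> and \<open>g = k z / (1 - z)\<close> turn every estimate into an equality:
  \<open>d = 1/2\<close>, \<open>a\<^sub>n = 1\<close>, \<open>b\<^sub>n = k\<close>. The sum is \<open>(1 + k) \<Phi>\<^sub>1(r)\<close>, which exceeds \<open>1/2\<close> just beyond
  \<open>R\<close> by assumption.
\<close>

section \<open>Means over circles and Taylor coefficients\<close>

lemma power_series_has_fps_expansion:
  assumes "\<And>z. z \<in> ball 0 1 \<Longrightarrow> (\<lambda>n. c n * z ^ n) sums F (z::complex)"
  shows "F has_fps_expansion Abs_fps c"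
proof -
  have "summable (\<lambda>n. c n * (1/2) ^ n)"
    using assms[of "1/2"] by (auto simp: sums_iff)
  hence "conv_radius c \<ge> norm (1/2 :: complex)"
    by (rule conv_radius_geI)
  hence "fps_conv_radius (Abs_fps c) > 0"
    unfolding fps_conv_radius_def
    by (simp add: fps_nth_Abs_fps)
      (meson ereal_less(2) less_le_trans zero_less_divide_1_iff zero_less_numeral)
  moreover have "\<forall>\<^sub>F z in nhds 0. eval_fps (Abs_fps c) z = F z"
    using assms by (auto simp: eventually_nhds eval_fps_def sums_iff intro!: exI[of _ "ball 0 1"])
  ultimately show ?thesis
    by (simp add: has_fps_expansion_def)
qed

lemma norm_circlepath_0: "0 \<le> \<rho> \<Longrightarrow> norm (circlepath 0 \<rho> t) = \<rho>"
  by (simp add: circlepath norm_mult)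

text \<open>
  Means over the circle of radius \<open>\<rho>\<close> are integrals over the parameter interval of \<open>circlepath 0 \<rho>\<close>,
  which runs through the circle at constant speed. In this form Cauchy's formula says that dividing by
  \<open>z ^ n\<close> and averaging extracts the \<open>n\<close>-th coefficient. All coefficient estimates below rest on it.
\<close>

lemma circle_mean_coeff:
  assumes "F has_fps_expansion P" "F holomorphic_on ball 0 1" "0 < \<rho>" "\<rho> < 1"
  shows "((\<lambda>t. F (circlepath 0 \<rho> t) / circlepath 0 \<rho> t ^ n) has_integral fps_nth P n) {0..1}"
proof -
  define \<gamma> where "\<gamma> = circlepath 0 \<rho>"
  have "((\<lambda>u. F u / (u - 0) ^ Suc n) has_contour_integral
      2 * pi * \<i> / fact n * (deriv ^^ n) F 0) (circlepath 0 \<rho>)"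
  proof (rule Cauchy_has_contour_integral_higher_derivative_circlepath)
    have "cball 0 \<rho> \<subseteq> ball (0::complex) 1" using assms by auto
    then show "continuous_on (cball 0 \<rho>) F"
      using assms(2) holomorphic_on_imp_continuous_on holomorphic_on_subset by blast
    show "F holomorphic_on ball 0 \<rho>"
      using assms by (auto intro: holomorphic_on_subset)
  qed (use assms in auto)
  then have "((\<lambda>t. 1 / (2 * pi * \<i>) * (F (\<gamma> t) / (\<gamma> t - 0) ^ Suc n * vector_derivative \<gamma> (at t)))
      has_integral 1 / (2 * pi * \<i>) * (2 * pi * \<i> / fact n * (deriv ^^ n) F 0)) {0..1}"
    unfolding has_contour_integral \<gamma>_def by (rule has_integral_mult_right)
  moreover have "1 / (2 * pi * \<i>) * (2 * pi * \<i> / fact n * (deriv ^^ n) F 0) = fps_nth P n"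
    by (simp add: fps_nth_fps_expansion[OF assms(1)])
  moreover have "1 / (2 * pi * \<i>) * (F (\<gamma> t) / (\<gamma> t - 0) ^ Suc n * vector_derivative \<gamma> (at t)) =
      F (\<gamma> t) / \<gamma> t ^ n" for t
  proof -
    have "\<gamma> t \<noteq> 0"
      using norm_circlepath_0[of \<rho> t] assms(3) by (auto simp: \<gamma>_def)
    moreover have "vector_derivative \<gamma> (at t) = 2 * pi * \<i> * \<gamma> t"
      unfolding \<gamma>_def vector_derivative_circlepath by (simp add: circlepath)
    ultimately show ?thesis by (simp add: field_simps)
  qed
  ultimately show ?thesis by (simp add: \<gamma>_def)
qed

lemma circle_mean_times_power:
  assumes "F holomorphic_on ball 0 1" "0 < \<rho>" "\<rho> < 1"
  shows "((\<lambda>t. F (circlepath 0 \<rho> t) * circlepath 0 \<rho> t ^ n) has_integral F 0 * 0 ^ n) {0..1}"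
proof -
  let ?G = "\<lambda>z. F z * z ^ n"
  have hol: "?G holomorphic_on ball 0 1"
    by (intro holomorphic_intros assms)
  then have exp: "?G has_fps_expansion fps_expansion ?G 0"
    by (intro has_fps_expansion_fps_expansion[of "ball 0 1"]) auto
  show ?thesis
    using circle_mean_coeff[OF exp hol assms(2,3), of 0]
    by (simp add: fps_expansion_def)
qed

text \<open>
  On the circle of radius \<open>\<rho>\<close> the conjugate is \<open>\<rho>\<^sup>2 / z\<close>. This turns a pairing with a conjugated
  power into a coefficient integral.
\<close>

lemma cnj_power_on_circle:
  assumes "norm z = \<rho>" "0 < \<rho>"
  shows "cnj z ^ n = of_real \<rho> ^ (2 * n) / z ^ n"
proof -
  have "of_real \<rho> ^ 2 = z * cnj z"
    using complex_norm_square[of z] assms by simp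
  then have "of_real \<rho> ^ (2 * n) = z ^ n * cnj z ^ n"
    by (simp add: power_mult power_mult_distrib)
  moreover have "z \<noteq> 0" using assms by auto
  ultimately show ?thesis by simp
qed

lemma circle_mean_cnj_over_power:
  assumes "F holomorphic_on ball 0 1" "0 < \<rho>" "\<rho> < 1" "0 < n"
  shows "((\<lambda>t. cnj (F (circlepath 0 \<rho> t)) / circlepath 0 \<rho> t ^ n) has_integral 0) {0..1}"
proof -
  define \<gamma> where "\<gamma> = circlepath 0 \<rho>"
  have "((\<lambda>t. cnj (F (\<gamma> t) * \<gamma> t ^ n)) has_integral cnj (F 0 * 0 ^ n)) {0..1}"
    using has_integral_linear[OF circle_mean_times_power[OF assms(1-3), of n] bounded_linear_cnj]
    by (simp add: o_def \<gamma>_def)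
  then have "((\<lambda>t. cnj (F (\<gamma> t) * \<gamma> t ^ n) / of_real \<rho> ^ (2 * n)) has_integral
      cnj (F 0 * 0 ^ n) / of_real \<rho> ^ (2 * n)) {0..1}"
    by (rule has_integral_divide)
  moreover have "cnj (F (\<gamma> t) * \<gamma> t ^ n) / of_real \<rho> ^ (2 * n) = cnj (F (\<gamma> t)) / \<gamma> t ^ n" for t
    using cnj_power_on_circle[of "\<gamma> t" \<rho> n] norm_circlepath_0[of \<rho> t] assms(2)
    by (simp add: \<gamma>_def)
  ultimately show ?thesis
    using assms(4) by (simp add: \<gamma>_def power_0_left)
qed

text \<open>
  Adding the vanishing antiholomorphic mean to the integral for the coefficient replaces \<open>F\<close> by
  \<open>2 Re F\<close>. Since this is nonnegative, its absolute mean is its mean \<open>2 Re (F 0)\<close>.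
\<close>

lemma caratheodory_coeff_bound:
  fixes F :: "complex \<Rightarrow> complex"
  assumes exp: "F has_fps_expansion P" and hol: "F holomorphic_on ball 0 1"
    and pos: "\<And>z. z \<in> ball 0 1 \<Longrightarrow> 0 \<le> Re (F z)" and n: "0 < n"
  shows "norm (fps_nth P n) \<le> 2 * Re (F 0)"
proof -
  have bound: "norm (fps_nth P n) * \<rho> ^ n \<le> 2 * Re (F 0)" if \<rho>: "0 < \<rho>" "\<rho> < 1" for \<rho>
  proof -
    define \<gamma> where "\<gamma> = circlepath 0 \<rho>"
    have n\<gamma>: "norm (\<gamma> t) = \<rho>" for t
      using \<rho> by (simp add: \<gamma>_def norm_circlepath_0)
    have in_disc: "\<gamma> t \<in> ball 0 1" for t
      using n\<gamma>[of t] \<rho> by simp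
    have conj: "((\<lambda>t. cnj (F (\<gamma> t)) / \<gamma> t ^ n) has_integral 0) {0..1}"
      using circle_mean_cnj_over_power[OF hol \<rho> n] unfolding \<gamma>_def .
    have "((\<lambda>t. F (\<gamma> t) / \<gamma> t ^ n + cnj (F (\<gamma> t)) / \<gamma> t ^ n) has_integral fps_nth P n + 0) {0..1}"
      using circle_mean_coeff[OF exp hol \<rho>, of n] conj
      unfolding \<gamma>_def by (intro has_integral_add)
    then have int1: "((\<lambda>t. of_real (2 * Re (F (\<gamma> t))) / \<gamma> t ^ n) has_integral fps_nth P n) {0..1}"
      by (simp add: add_divide_distrib[symmetric] complex_add_cnj)
    have "((\<lambda>t. Re (F (\<gamma> t))) has_integral Re (F 0)) {0..1}"
      using has_integral_linear[OF circle_mean_times_power[OF hol \<rho>, of 0] bounded_linear_Re]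
      by (simp add: o_def \<gamma>_def)
    then have int2: "((\<lambda>t. 2 * Re (F (\<gamma> t)) / \<rho> ^ n) has_integral 2 * Re (F 0) / \<rho> ^ n) {0..1}"
      by (intro has_integral_divide has_integral_mult_right)
    have "norm (integral {0..1} (\<lambda>t. of_real (2 * Re (F (\<gamma> t))) / \<gamma> t ^ n))
        \<le> integral {0..1} (\<lambda>t. 2 * Re (F (\<gamma> t)) / \<rho> ^ n)"
      using has_integral_integrable[OF int1] has_integral_integrable[OF int2]
    proof (rule integral_norm_bound_integral)
      show "norm (of_real (2 * Re (F (\<gamma> t))) / \<gamma> t ^ n) \<le> 2 * Re (F (\<gamma> t)) / \<rho> ^ n" for t
        using pos[OF in_disc, of t] unfolding norm_divide norm_power n\<gamma> norm_of_real by simp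
    qed
    then have "norm (fps_nth P n) \<le> 2 * Re (F 0) / \<rho> ^ n"
      unfolding integral_unique[OF int1] integral_unique[OF int2] .
    then show ?thesis using \<rho> by (simp add: field_simps)
  qed
  have "((\<lambda>\<rho>. norm (fps_nth P n) * \<rho> ^ n) \<longlongrightarrow> norm (fps_nth P n) * 1 ^ n) (at_left 1)"
    by (intro tendsto_intros)
  moreover have "\<forall>\<^sub>F \<rho> in at_left (1::real). norm (fps_nth P n) * \<rho> ^ n \<le> 2 * Re (F 0)"
    using bound by (auto simp: eventually_at_left_field intro!: exI[of _ 0])
  ultimately show ?thesis
    using tendsto_upperbound[of _ "norm (fps_nth P n) * 1 ^ n" "at_left (1::real)"] by simp
qed

section \<open>Multiplication by a bounded function and partial sums of squares\<close>

lemma truncated_power_series_has_fps_expansion: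
  fixes q :: "nat \<Rightarrow> complex"
  shows "(\<lambda>z. \<Sum>n<N. q n * z ^ n) has_fps_expansion Abs_fps (\<lambda>n. if n < N then q n else 0)"
proof (rule power_series_has_fps_expansion)
  fix z :: complex
  have "(\<lambda>n. if n \<in> {..<N} then q n * z ^ n else 0) sums (\<Sum>n<N. q n * z ^ n)"
    by (rule sums_If_finite_set) simp
  then show "(\<lambda>n. (if n < N then q n else 0) * z ^ n) sums (\<Sum>n<N. q n * z ^ n)"
    by (rule sums_cong[THEN iffD1, rotated]) auto
qed

lemma circle_mean_mult_cnj_poly:
  assumes exp: "F has_fps_expansion P" and hol: "F holomorphic_on ball 0 1"
    and \<rho>: "0 < \<rho>" "\<rho> < 1"
  shows "((\<lambda>t. F (circlepath 0 \<rho> t) * cnj (\<Sum>n<N. q n * circlepath 0 \<rho> t ^ n)) has_integral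
           (\<Sum>n<N. fps_nth P n * cnj (q n) * of_real \<rho> ^ (2 * n))) {0..1}"
proof -
  define \<gamma> where "\<gamma> = circlepath 0 \<rho>"
  have "((\<lambda>t. F (\<gamma> t) / \<gamma> t ^ n * (cnj (q n) * of_real \<rho> ^ (2 * n))) has_integral
        fps_nth P n * (cnj (q n) * of_real \<rho> ^ (2 * n))) {0..1}" for n
    using circle_mean_coeff[OF exp hol \<rho>, of n] unfolding \<gamma>_def by (rule has_integral_mult_left)
  then have "((\<lambda>t. \<Sum>n<N. F (\<gamma> t) / \<gamma> t ^ n * (cnj (q n) * of_real \<rho> ^ (2 * n))) has_integral
        (\<Sum>n<N. fps_nth P n * (cnj (q n) * of_real \<rho> ^ (2 * n)))) {0..1}"
    by (intro has_integral_sum) auto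
  moreover have "F (\<gamma> t) / \<gamma> t ^ n * (cnj (q n) * of_real \<rho> ^ (2 * n)) = F (\<gamma> t) * (cnj (q n) * cnj (\<gamma> t) ^ n)"
    for t n
    using cnj_power_on_circle[of "\<gamma> t" \<rho> n] norm_circlepath_0[of \<rho> t] \<rho>
    by (simp add: \<gamma>_def)
  ultimately show ?thesis
    by (simp add: sum_distrib_left \<gamma>_def mult.assoc)
qed

lemma parseval_poly:
  assumes "0 < \<rho>" "\<rho> < 1"
  shows "((\<lambda>t. (norm (\<Sum>n<N. q n * circlepath 0 \<rho> t ^ n))\<^sup>2) has_integral
          (\<Sum>n<N. (norm (q n))\<^sup>2 * \<rho> ^ (2 * n))) {0..1}"
proof -
  let ?Q = "\<lambda>z. \<Sum>n<N. q n * z ^ n"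
  have "?Q holomorphic_on ball 0 1" by (intro holomorphic_intros)
  from has_integral_linear[OF circle_mean_mult_cnj_poly[OF
      truncated_power_series_has_fps_expansion this assms, where N = N and q = q] bounded_linear_Re]
  have "((\<lambda>t. Re (?Q (circlepath 0 \<rho> t) * cnj (?Q (circlepath 0 \<rho> t)))) has_integral
      Re (\<Sum>n<N. q n * cnj (q n) * of_real \<rho> ^ (2 * n))) {0..1}"
    by (simp add: o_def)
  moreover have "Re (z * cnj z) = (norm z)\<^sup>2" for z
    by (metis Re_complex_of_real complex_norm_square of_real_power)
  moreover have "(\<Sum>n<N. q n * cnj (q n) * of_real \<rho> ^ (2 * n)) =
      of_real (\<Sum>n<N. (norm (q n))\<^sup>2 * \<rho> ^ (2 * n))"
    by (simp flip: complex_norm_square)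
  ultimately show ?thesis
    by (simp only: Re_complex_of_real)
qed

lemma continuous_on_circlepath_compose:
  assumes "F holomorphic_on ball 0 1" "0 < \<rho>" "\<rho> < 1"
  shows "continuous_on {0..1} (\<lambda>t. F (circlepath 0 \<rho> t))"
proof (rule continuous_on_compose2[OF holomorphic_on_imp_continuous_on[OF assms(1)]])
  show "circlepath 0 \<rho> ` {0..1} \<subseteq> ball 0 1"
    using assms by (auto simp: norm_circlepath_0)
qed (auto simp: circlepath intro!: continuous_intros)

text \<open>
  Bessel's inequality: the mean of \<open>\<bar>F - Q\<bar>\<^sup>2\<close> is nonnegative for the Taylor polynomial \<open>Q\<close> of \<open>F\<close>, and
  the cross term and the square of \<open>Q\<close> both have the sum on the left as their mean.
\<close>

lemma bessel_inequality_circle: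
  assumes exp: "F has_fps_expansion P" and hol: "F holomorphic_on ball 0 1"
    and \<rho>: "0 < \<rho>" "\<rho> < 1"
  shows "(\<Sum>n<N. (norm (fps_nth P n))\<^sup>2 * \<rho> ^ (2 * n)) \<le>
    integral {0..1} (\<lambda>t. (norm (F (circlepath 0 \<rho> t)))\<^sup>2)"
proof -
  let ?S = "\<Sum>n<N. (norm (fps_nth P n))\<^sup>2 * \<rho> ^ (2 * n)"
  define Q where "Q = (\<lambda>t. \<Sum>n<N. fps_nth P n * circlepath 0 \<rho> t ^ n)"
  define f where "f = (\<lambda>t. F (circlepath 0 \<rho> t))"
  have "((\<lambda>t. Re (f t * cnj (Q t))) has_integral
      Re (\<Sum>n<N. fps_nth P n * cnj (fps_nth P n) * of_real \<rho> ^ (2 * n))) {0..1}"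
    using has_integral_linear[OF circle_mean_mult_cnj_poly[OF exp hol \<rho>] bounded_linear_Re]
    by (simp add: o_def f_def Q_def)
  then have "((\<lambda>t. Re (f t * cnj (Q t))) has_integral ?S) {0..1}"
    by (simp flip: complex_norm_square of_real_power of_real_mult)
  then have "((\<lambda>t. 2 * Re (f t * cnj (Q t)) - (norm (Q t))\<^sup>2) has_integral 2 * ?S - ?S) {0..1}"
    using parseval_poly[OF \<rho>, where q = "fps_nth P" and N = N]
    unfolding Q_def by (intro has_integral_diff has_integral_mult_right)
  moreover have "(\<lambda>t. (norm (f t))\<^sup>2) integrable_on {0..1}"
    unfolding f_def
    by (intro integrable_continuous_interval continuous_on_power continuous_on_norm
        continuous_on_circlepath_compose hol \<rho>)
  moreover have "2 * Re (f t * cnj (Q t)) - (norm (Q t))\<^sup>2 \<le> (norm (f t))\<^sup>2" for t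
  proof -
    have "0 \<le> (norm (f t - Q t))\<^sup>2" by simp
    also have "\<dots> = (norm (f t))\<^sup>2 - 2 * Re (f t * cnj (Q t)) + (norm (Q t))\<^sup>2"
      unfolding cmod_power2 by (simp add: power2_eq_square algebra_simps)
    finally show ?thesis by simp
  qed
  ultimately have "2 * ?S - ?S \<le> integral {0..1} (\<lambda>t. (norm (f t))\<^sup>2)"
    by (intro has_integral_le[OF _ integrable_integral]) auto
  then show ?thesis by (simp add: f_def)
qed

text \<open>
  The first \<open>N\<close> coefficients of \<open>w H\<close> depend only on the first \<open>N\<close> coefficients of \<open>H\<close>. Hence \<open>H\<close> may
  be replaced by its Taylor polynomial \<open>p\<close>: Bessel's inequality for \<open>w p\<close>, the bound on \<open>w\<close> and
  Parseval's identity for \<open>p\<close> compare the partial sums, not only the full ones, and this is what allows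
  decreasing weights later.
\<close>

lemma bounded_multiplier_partial_square_sums:
  assumes expG: "G has_fps_expansion Q" and expH: "H has_fps_expansion P"
    and hol: "w holomorphic_on ball 0 1" and k: "0 \<le> k"
    and wk: "\<And>z. z \<in> ball 0 1 \<Longrightarrow> norm (w z) \<le> k"
    and eq: "\<And>z. z \<in> ball 0 1 \<Longrightarrow> G z = w z * H z"
  shows "(\<Sum>n<N. (norm (fps_nth Q n))\<^sup>2) \<le> k\<^sup>2 * (\<Sum>n<N. (norm (fps_nth P n))\<^sup>2)"
proof -
  define W where "W = fps_expansion w 0"
  have expw: "w has_fps_expansion W"
    unfolding W_def using hol by (intro has_fps_expansion_fps_expansion[of "ball 0 1"]) auto
  define p where "p = (\<lambda>z. \<Sum>n<N. fps_nth P n * z ^ n)"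
  define P' where "P' = Abs_fps (\<lambda>n. if n < N then fps_nth P n else 0)"
  have expp: "p has_fps_expansion P'"
    unfolding p_def P'_def by (rule truncated_power_series_has_fps_expansion)
  have expF: "(\<lambda>z. w z * p z) has_fps_expansion W * P'"
    by (rule has_fps_expansion_mult[OF expw expp])
  have holF: "(\<lambda>z. w z * p z) holomorphic_on ball 0 1"
    unfolding p_def by (intro holomorphic_intros hol)
  have "\<forall>\<^sub>F z in nhds 0. G z = w z * H z"
    using eq by (auto simp: eventually_nhds intro!: exI[of _ "ball 0 1"])
  then have "(\<lambda>z. w z * H z) has_fps_expansion Q"
    using expG has_fps_expansion_cong[OF _ refl] by fast
  then have "Q = W * P"
    using fps_expansion_unique_complex has_fps_expansion_mult[OF expw expH] by blast
  then have coeff: "fps_nth Q n = fps_nth (W * P') n" if "n < N" for n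
    using that by (auto simp: fps_mult_nth P'_def intro!: sum.cong)
  have bound: "(\<Sum>n<N. (norm (fps_nth Q n))\<^sup>2 * \<rho> ^ (2 * n)) \<le>
      k\<^sup>2 * (\<Sum>n<N. (norm (fps_nth P n))\<^sup>2 * \<rho> ^ (2 * n))" if \<rho>: "0 < \<rho>" "\<rho> < 1" for \<rho>
  proof -
    let ?\<gamma> = "circlepath 0 \<rho>"
    have "(\<Sum>n<N. (norm (fps_nth Q n))\<^sup>2 * \<rho> ^ (2 * n)) =
        (\<Sum>n<N. (norm (fps_nth (W * P') n))\<^sup>2 * \<rho> ^ (2 * n))"
      by (simp add: coeff)
    also have "\<dots> \<le> integral {0..1} (\<lambda>t. (norm (w (?\<gamma> t) * p (?\<gamma> t)))\<^sup>2)"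
      by (rule bessel_inequality_circle[OF expF holF \<rho>])
    also have "\<dots> \<le> integral {0..1} (\<lambda>t. k\<^sup>2 * (norm (p (?\<gamma> t)))\<^sup>2)"
    proof (rule integral_le)
      have in_disc: "?\<gamma> t \<in> ball 0 1" for t
        using norm_circlepath_0[of \<rho> t] \<rho> by simp
      show "(\<lambda>t. (norm (w (?\<gamma> t) * p (?\<gamma> t)))\<^sup>2) integrable_on {0..1}"
        by (intro integrable_continuous_interval continuous_on_power continuous_on_norm
            continuous_on_circlepath_compose[OF holF \<rho>])
      show "(\<lambda>t. k\<^sup>2 * (norm (p (?\<gamma> t)))\<^sup>2) integrable_on {0..1}"
        using parseval_poly[OF \<rho>, where q = "fps_nth P" and N = N]
        unfolding p_def by (intro integrable_on_mult_right has_integral_integrable)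
      show "(norm (w (?\<gamma> t) * p (?\<gamma> t)))\<^sup>2 \<le> k\<^sup>2 * (norm (p (?\<gamma> t)))\<^sup>2" for t
        using wk[OF in_disc, of t] by (simp add: norm_mult power_mult_distrib mult_right_mono power_mono)
    qed
    also have "\<dots> = k\<^sup>2 * (\<Sum>n<N. (norm (fps_nth P n))\<^sup>2 * \<rho> ^ (2 * n))"
      using has_integral_mult_right[OF parseval_poly[OF \<rho>, where q = "fps_nth P" and N = N], of "k\<^sup>2"]
      unfolding p_def by (rule integral_unique)
    finally show ?thesis .
  qed
  have "((\<lambda>\<rho>. \<Sum>n<N. (norm (fps_nth Q n))\<^sup>2 * \<rho> ^ (2 * n)) \<longlongrightarrow> (\<Sum>n<N. (norm (fps_nth Q n))\<^sup>2 * 1 ^ (2 * n)))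
      (at_left 1)"
    by (intro tendsto_intros)
  moreover have "((\<lambda>\<rho>. k\<^sup>2 * (\<Sum>n<N. (norm (fps_nth P n))\<^sup>2 * \<rho> ^ (2 * n))) \<longlongrightarrow>
      k\<^sup>2 * (\<Sum>n<N. (norm (fps_nth P n))\<^sup>2 * 1 ^ (2 * n))) (at_left 1)"
    by (intro tendsto_intros)
  moreover have "\<forall>\<^sub>F \<rho> in at_left (1::real). (\<Sum>n<N. (norm (fps_nth Q n))\<^sup>2 * \<rho> ^ (2 * n)) \<le>
      k\<^sup>2 * (\<Sum>n<N. (norm (fps_nth P n))\<^sup>2 * \<rho> ^ (2 * n))"
    using bound by (auto simp: eventually_at_left_field intro!: exI[of _ 0])
  ultimately have "(\<Sum>n<N. (norm (fps_nth Q n))\<^sup>2 * 1 ^ (2 * n)) \<le>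
      k\<^sup>2 * (\<Sum>n<N. (norm (fps_nth P n))\<^sup>2 * 1 ^ (2 * n))"
    by (intro tendsto_le[OF trivial_limit_at_left_real])
  then show ?thesis by simp
qed

text \<open>
  The quotient \<open>G / H\<close> is meromorphic and, with division by zero giving \<open>0\<close>, bounded by \<open>k\<close> on all of
  \<open>S\<close>, zeros of \<open>H\<close> included. A bounded meromorphic function has no poles, so removing its
  singularities makes it holomorphic.
\<close>

lemma bounded_quotient_factorization:
  fixes G H :: "complex \<Rightarrow> complex"
  assumes G: "G holomorphic_on S" and H: "H holomorphic_on S" and S: "open S"
    and k: "0 \<le> k" and le: "\<And>z. z \<in> S \<Longrightarrow> norm (G z) \<le> k * norm (H z)"
  obtains w where "w holomorphic_on S" "\<And>z. z \<in> S \<Longrightarrow> norm (w z) \<le> k"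
    "\<And>z. z \<in> S \<Longrightarrow> G z = w z * H z"
proof -
  define q where "q = (\<lambda>z. G z / H z)"
  have an: "G analytic_on S" "H analytic_on S"
    using G H S by (auto simp: analytic_on_open)
  have mero: "q meromorphic_on S"
    unfolding q_def using an by (intro meromorphic_on_divide analytic_on_imp_meromorphic_on)
  have q_le: "norm (q z) \<le> k" if "z \<in> S" for z
    using le[OF that] k by (cases "H z = 0") (auto simp: q_def norm_divide field_simps)
  have nice: "remove_sings q nicely_meromorphic_on S"
    using mero by (rule remove_sings_nicely_meromorphic)
  have ev: "\<forall>\<^sub>F u in at z. norm (remove_sings q u) \<le> k" if "z \<in> S" for z
  proof -
    have "isolated_singularity_at q z"
      using mero that by (meson meromorphic_on_isolated_singularity meromorphic_on_subset empty_subsetI insert_subset)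
    then have "\<forall>\<^sub>F u in at z. remove_sings q u = q u"
      by (rule eventually_remove_sings_eq_at)
    moreover have "\<forall>\<^sub>F u in at z. u \<in> S"
      using S that by (simp add: eventually_at_in_open')
    ultimately show ?thesis by eventually_elim (simp add: q_le)
  qed
  have an_w: "remove_sings q analytic_on {z}" if z: "z \<in> S" for z
  proof (rule nicely_meromorphic_on_imp_analytic_at[OF nice z])
    show "\<not> is_pole (remove_sings q) z"
    proof
      assume "is_pole (remove_sings q) z"
      then have "\<forall>\<^sub>F u in at z. norm (remove_sings q u) \<ge> k + 1"
        unfolding is_pole_def using filterlim_at_infinity[of 0 "remove_sings q" "at z"] k
        by (auto dest!: spec[of _ "k + 1"])
      with ev[OF z] have "\<forall>\<^sub>F u in at z. False"
        by eventually_elim auto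
      then show False by simp
    qed
  qed
  show thesis
  proof (rule that[of "remove_sings q"])
    show "remove_sings q holomorphic_on S"
      using an_w analytic_on_analytic_at analytic_imp_holomorphic by blast
    show "norm (remove_sings q z) \<le> k" if "z \<in> S" for z
    proof (rule tendsto_upperbound)
      show "((\<lambda>u. norm (remove_sings q u)) \<longlongrightarrow> norm (remove_sings q z)) (at z)"
        using analytic_at_imp_isCont[OF an_w[OF that]] by (intro tendsto_norm) (simp add: isCont_def)
    qed (use ev that in auto)
    \<comment> \<open>At a zero of \<open>H\<close> the domination forces \<open>G\<close> to vanish too, so the identity holds there for any
        value of the factor.\<close>
    show "G z = remove_sings q z * H z" if z: "z \<in> S" for z
    proof (cases "H z = 0")
      case True
      then show ?thesis using le[OF z] by simp
    next
      case False
      then have "q analytic_on {z}"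
        unfolding q_def using an z by (intro analytic_on_divide) (auto intro: analytic_on_subset)
      then show ?thesis using False by (simp add: q_def)
    qed
  qed
qed

section \<open>Coefficients of functions subordinate to a convex map\<close>

text \<open>
  Otherwise the inverse map would be entire and bounded, contrary to Liouville's theorem. So the image has
  a boundary point, and the distance to the boundary is attained.
\<close>

lemma univalent_image_disc_ne_UNIV:
  assumes "\<psi> holomorphic_on ball 0 1" "inj_on \<psi> (ball 0 1)"
  shows "\<psi> ` ball 0 1 \<noteq> UNIV"
proof
  assume UNIV: "\<psi> ` ball 0 1 = UNIV"
  obtain g where g: "g holomorphic_on \<psi> ` ball 0 1" "\<And>z. z \<in> ball 0 1 \<Longrightarrow> g (\<psi> z) = z"
    using holomorphic_has_inverse[OF assms(1) open_ball assms(2)] by metis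
  have range: "range g = ball 0 1"
  proof -
    have "range g = (\<lambda>z. g (\<psi> z)) ` ball 0 1"
      by (metis UNIV image_image)
    then show ?thesis using g(2) by simp
  qed
  then have "g constant_on UNIV"
    using g(1) UNIV by (intro Liouville_theorem) auto
  then obtain c where "\<And>x. g x = c" by (auto simp: constant_on_def)
  then have "ball (0::complex) 1 = {c}" using range by auto
  moreover have "0 \<in> ball (0::complex) 1" "1/2 \<in> ball (0::complex) 1" by auto
  ultimately show False by (metis singletonD zero_neq_numeral divide_eq_0_iff zero_neq_one)
qed

text \<open>
  Any line separating the image from its boundary point \<open>p\<close> nearest to \<open>\<psi> 0\<close> will do: its distance from
  \<open>\<psi> 0\<close> is at most the distance from \<open>\<psi> 0\<close> to \<open>p\<close>.
\<close>

lemma convex_image_in_half_plane: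
  assumes "univalent_convex \<psi>"
  obtains u where "norm u = 1"
    "\<And>z. z \<in> ball 0 1 \<Longrightarrow> Re (u * (\<psi> z - \<psi> 0)) \<le> boundary_dist \<psi>"
proof -
  let ?\<Omega> = "\<psi> ` ball 0 1"
  have hol: "\<psi> holomorphic_on ball 0 1" and inj: "inj_on \<psi> (ball 0 1)" and cvx: "convex ?\<Omega>"
    using assms by (auto simp: univalent_convex_def)
  have "open ?\<Omega>"
    using hol inj by (intro open_mapping_thm3) auto
  have "frontier ?\<Omega> \<noteq> {}"
    using univalent_image_disc_ne_UNIV[OF hol inj] frontier_eq_empty[of ?\<Omega>] by auto
  then obtain p where p: "p \<in> frontier ?\<Omega>" "boundary_dist \<psi> = dist (\<psi> 0) p"
    unfolding boundary_dist_def using infdist_attains_inf[of "frontier ?\<Omega>" "\<psi> 0"] by auto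
  have "p \<notin> ?\<Omega>"
    using p(1) \<open>open ?\<Omega>\<close> by (simp add: frontier_def interior_open)
  then obtain v b where v: "v \<noteq> 0" "\<And>x. x \<in> ?\<Omega> \<Longrightarrow> inner v x \<le> b" "b \<le> inner v p"
    using separating_hyperplane_sets[OF cvx convex_singleton[of p]] by auto
  show thesis
  proof (rule that[of "cnj v / norm v"])
    show "norm (cnj v / norm v) = 1" using v(1) by (simp add: norm_divide)
    fix z :: complex assume "z \<in> ball 0 1"
    then have "inner v (\<psi> z) \<le> inner v p" using v(2)[of "\<psi> z"] v(3) by fastforce
    then have "inner v (\<psi> z - \<psi> 0) \<le> inner v (p - \<psi> 0)" by (simp add: inner_diff_right)
    also have "\<dots> \<le> norm v * norm (p - \<psi> 0)" by (rule norm_cauchy_schwarz)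
    finally have "inner v (\<psi> z - \<psi> 0) / norm v \<le> dist (\<psi> 0) p"
      using v(1) by (simp add: dist_norm norm_minus_commute field_simps)
    moreover have "Re (cnj v / norm v * (\<psi> z - \<psi> 0)) = inner v (\<psi> z - \<psi> 0) / norm v"
      by (simp add: inner_complex_def add_divide_distrib diff_divide_distrib algebra_simps)
    ultimately show "Re (cnj v / norm v * (\<psi> z - \<psi> 0)) \<le> boundary_dist \<psi>"
      by (simp only: p(2))
  qed
qed

text \<open>
  The values of \<open>h\<close> lie in the half-plane of \<open>convex_image_in_half_plane\<close>, so \<open>d - u (h - h 0)\<close>, where \<open>d\<close> is
  the boundary distance, has nonnegative real part. Its value at \<open>0\<close> is \<open>d\<close>, and up to the unimodular
  factor \<open>u\<close> and a sign it has the positive-order coefficients of \<open>h\<close>.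
\<close>

lemma subordinate_convex_coeff_bound:
  assumes \<psi>: "univalent_convex \<psi>" and sub: "subordinate h \<psi>"
    and hol: "h holomorphic_on ball 0 1" and exp: "h has_fps_expansion A" and n: "0 < n"
  shows "norm (fps_nth A n) \<le> 2 * boundary_dist \<psi>"
proof -
  obtain u where u: "norm u = 1"
    "\<And>z. z \<in> ball 0 1 \<Longrightarrow> Re (u * (\<psi> z - \<psi> 0)) \<le> boundary_dist \<psi>"
    using convex_image_in_half_plane[OF \<psi>] by blast
  obtain \<omega> where \<omega>: "\<omega> 0 = 0" "\<And>z. z \<in> ball 0 1 \<Longrightarrow> norm (\<omega> z) < 1 \<and> h z = \<psi> (\<omega> z)"
    using sub unfolding subordinate_def by blast
  have h0: "h 0 = \<psi> 0" using \<omega>(1) \<omega>(2)[of 0] by simp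
  let ?F = "\<lambda>z. of_real (boundary_dist \<psi>) - u * (h z - h 0)"
  have expF: "?F has_fps_expansion
      fps_const (of_real (boundary_dist \<psi>)) - fps_const u * (A - fps_const (h 0))"
    by (intro fps_expansion_intros exp)
  have "norm (fps_nth (fps_const (of_real (boundary_dist \<psi>)) - fps_const u * (A - fps_const (h 0))) n)
      \<le> 2 * Re (?F 0)"
  proof (rule caratheodory_coeff_bound[OF expF])
    show "?F holomorphic_on ball 0 1" by (intro holomorphic_intros hol)
    fix z :: complex assume "z \<in> ball 0 1"
    then have "Re (u * (h z - h 0)) \<le> boundary_dist \<psi>"
      using \<omega>(2)[of z] u(2)[of "\<omega> z"] h0 by simp
    then show "0 \<le> Re (?F z)" by (simp del: times_complex.simps)
  qed (rule n)
  then show ?thesis using n u(1) by (simp add: norm_mult)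
qed

section \<open>The weighted coefficient inequality\<close>

text \<open>
  Abel summation. For \<open>c = y - x\<close>, whose partial sums are nonnegative, the induction carries the
  stronger bound that the sum of \<open>c n * v n\<close> below \<open>N\<close> is at least \<open>v N\<close> times the unweighted sum.
\<close>

lemma sum_mult_antimono_weights_mono:
  fixes x y v :: "nat \<Rightarrow> real"
  assumes le: "\<And>N. (\<Sum>n<N. x n) \<le> (\<Sum>n<N. y n)"
    and v: "antimono v" "\<And>n. 0 \<le> v n"
  shows "(\<Sum>n<N. x n * v n) \<le> (\<Sum>n<N. y n * v n)"
proof -
  have "(\<Sum>n<N. y n - x n) * v N \<le> (\<Sum>n<N. (y n - x n) * v n)" for N
  proof (induction N)
    case (Suc N)
    have "(\<Sum>n<Suc N. y n - x n) * v (Suc N) \<le> (\<Sum>n<Suc N. y n - x n) * v N"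
    proof (rule mult_left_mono)
      show "v (Suc N) \<le> v N" using v(1) by (simp add: antimono_def)
      show "0 \<le> (\<Sum>n<Suc N. y n - x n)" using le[of "Suc N"] by (simp only: sum_subtractf)
    qed
    then show ?case using Suc by (simp add: algebra_simps)
  qed simp
  moreover have "0 \<le> (\<Sum>n<N. y n - x n) * v N"
    using le[of N] v(2) by (simp add: sum_subtractf)
  ultimately have "0 \<le> (\<Sum>n<N. (y n - x n) * v n)"
    using order_trans by blast
  then show ?thesis by (simp add: algebra_simps sum_subtractf)
qed

lemma F_class_summable:
  assumes "\<phi> \<in> F_class" "0 \<le> r" "r < 1"
  shows "summable (\<lambda>n. \<phi> (Suc n) r)"
proof -
  have "\<forall>x\<in>{0..<1}. \<exists>d>0.
      uniformly_convergent_on (ball x d \<inter> {0..<1}) (\<lambda>N r. \<Sum>n<N. \<phi> n r)"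
    using assms(1) by (simp add: F_class_def)
  moreover have "r \<in> {0..<1}" using assms by simp
  ultimately obtain d where d: "d > 0"
    "uniformly_convergent_on (ball r d \<inter> {0..<1}) (\<lambda>N r. \<Sum>n<N. \<phi> n r)"
    by blast
  then have "convergent (\<lambda>N. \<Sum>n<N. \<phi> n r)"
    using assms by (intro uniformly_convergent_imp_convergent[OF d(2)]) auto
  then have "summable (\<lambda>n. \<phi> n r)" by (simp add: summable_iff_convergent)
  then show ?thesis by (subst summable_Suc_iff)
qed

text \<open>
  The sum over \<open>a\<close> is bounded termwise. For \<open>b\<close>, the factorization \<open>g' = w h'\<close> compares the partial sums
  of the squares of \<open>n b\<^sub>n\<close> and \<open>n a\<^sub>n\<close>. Monotonicity of the \<open>\<phi>\<^sub>n\<close> makes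
  \<open>\<phi>\<^sub>n / n\<^sup>2\<close> a decreasing weight, which removes the factors \<open>n\<^sup>2\<close> and inserts \<open>\<phi>\<^sub>n\<close>. The
  Cauchy--Schwarz inequality then returns from squares to first powers.
\<close>

lemma weighted_coeff_sum_bound:
  assumes adm: "admissible k \<psi> f h g a b" and k: "0 \<le> k" and \<phi>: "\<phi> \<in> F_dec"
    and r: "0 \<le> r" "r < 1"
  shows "summable (\<lambda>n. norm (a (Suc n)) * \<phi> (Suc n) r)"
    and "summable (\<lambda>n. norm (b (Suc n)) * \<phi> (Suc n) r)"
    and "(\<Sum>n. norm (a (Suc n)) * \<phi> (Suc n) r) + (\<Sum>n. norm (b (Suc n)) * \<phi> (Suc n) r)
           \<le> 2 * (1 + k) * Phi1 \<phi> r * boundary_dist \<psi>"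
proof -
  define d where "d = boundary_dist \<psi>"
  have d: "0 \<le> d" by (simp add: d_def boundary_dist_def infdist_nonneg)
  have \<psi>: "univalent_convex \<psi>" and sub: "subordinate h \<psi>"
    and hol: "h holomorphic_on ball 0 1" "g holomorphic_on ball 0 1"
    and h: "\<And>z. z \<in> ball 0 1 \<Longrightarrow> (\<lambda>n. a n * z ^ n) sums h z"
    and g: "\<And>z. z \<in> ball 0 1 \<Longrightarrow> (\<lambda>n. b (Suc n) * z ^ Suc n) sums g z"
    and dom: "\<And>z. z \<in> ball 0 1 \<Longrightarrow> norm (deriv g z) \<le> k * norm (deriv h z)"
    using adm by (auto simp: admissible_def harmonic_decomp_def)
  have exph: "h has_fps_expansion Abs_fps a"
    by (rule power_series_has_fps_expansion) (rule h)
  \<comment> \<open>\<open>b 0\<close> is arbitrary, so the constant coefficient \<open>0\<close> of \<open>g\<close> is put in its place.\<close>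
  have expg: "g has_fps_expansion Abs_fps (b(0 := 0))"
  proof (rule power_series_has_fps_expansion)
    fix z :: complex assume "z \<in> ball 0 1"
    from g[OF this] have "(\<lambda>n. (b(0 := 0)) (Suc n) * z ^ Suc n) sums g z" by simp
    from sums_Suc[OF this] show "(\<lambda>n. (b(0 := 0)) n * z ^ n) sums g z" by simp
  qed
  have a_le: "norm (a (Suc n)) \<le> 2 * d" for n
    using subordinate_convex_coeff_bound[OF \<psi> sub hol(1) exph, of "Suc n"] by (simp add: d_def)
  obtain w where w: "w holomorphic_on ball 0 1" "\<And>z. z \<in> ball 0 1 \<Longrightarrow> norm (w z) \<le> k"
    "\<And>z. z \<in> ball 0 1 \<Longrightarrow> deriv g z = w z * deriv h z"
    using bounded_quotient_factorization[OF holomorphic_deriv[OF hol(2)] holomorphic_deriv[OF hol(1)]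
        open_ball k dom] by auto
  have squares: "(\<Sum>n<N. (norm (of_nat (Suc n) * b (Suc n)))\<^sup>2)
      \<le> (\<Sum>n<N. k\<^sup>2 * (norm (of_nat (Suc n) * a (Suc n)))\<^sup>2)" for N
    using bounded_multiplier_partial_square_sums[OF has_fps_expansion_deriv[OF expg]
        has_fps_expansion_deriv[OF exph] w(1) k w(2,3), of N]
    by (simp add: sum_distrib_left add.commute)
  define p where "p = (\<lambda>n. \<phi> (Suc n) r)"
  have p0: "0 \<le> p n" and pdec: "p (Suc n) \<le> p n" for n
    using \<phi> r by (auto simp: p_def F_dec_def F_class_def)
  have psum: "summable p"
    unfolding p_def using \<phi> r by (intro F_class_summable) (auto simp: F_dec_def)
  have Phi: "suminf p = Phi1 \<phi> r" by (simp add: p_def Phi1_def)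
  have p_le: "(\<Sum>n<N. p n) \<le> suminf p" for N
    using psum p0 by (intro sum_le_suminf) auto
  have a_part: "(\<Sum>n<N. norm (a (Suc n)) * p n) \<le> 2 * d * suminf p" for N
  proof -
    have "(\<Sum>n<N. norm (a (Suc n)) * p n) \<le> (\<Sum>n<N. 2 * d * p n)"
      by (intro sum_mono mult_right_mono a_le p0)
    also have "\<dots> \<le> 2 * d * suminf p"
      unfolding sum_distrib_left[symmetric] using d by (intro mult_left_mono p_le) auto
    finally show ?thesis .
  qed
  have b_squares: "(\<Sum>n<N. (norm (b (Suc n)))\<^sup>2 * p n) \<le> (2 * d * k)\<^sup>2 * (\<Sum>n<N. p n)" for N
  proof -
    define v where "v = (\<lambda>n. p n / (real (Suc n))\<^sup>2)"
    have v: "antimono v" "\<And>n. 0 \<le> v n"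
      unfolding v_def antimono_iff_le_Suc
      by (auto intro!: frac_le pdec power_mono simp: p0)
    have "(\<Sum>n<N. (norm (of_nat (Suc n) * b (Suc n)))\<^sup>2 * v n)
        \<le> (\<Sum>n<N. (k\<^sup>2 * (norm (of_nat (Suc n) * a (Suc n)))\<^sup>2) * v n)"
      by (rule sum_mult_antimono_weights_mono[OF squares v])
    moreover have "(norm (of_nat (Suc n) * c))\<^sup>2 * v n = (norm c)\<^sup>2 * p n" for n and c :: complex
      unfolding v_def norm_mult norm_of_nat power_mult_distrib by (simp del: of_nat_Suc)
    ultimately have "(\<Sum>n<N. (norm (b (Suc n)))\<^sup>2 * p n) \<le> (\<Sum>n<N. k\<^sup>2 * ((norm (a (Suc n)))\<^sup>2 * p n))"
      by (simp only: mult.assoc)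
    also have "\<dots> \<le> (\<Sum>n<N. k\<^sup>2 * ((2 * d)\<^sup>2 * p n))"
      by (intro sum_mono mult_left_mono mult_right_mono power_mono a_le p0) auto
    also have "\<dots> = (2 * d * k)\<^sup>2 * (\<Sum>n<N. p n)"
      by (simp add: sum_distrib_left sum_distrib_right power_mult_distrib mult_ac)
    finally show ?thesis .
  qed
  have b_part: "(\<Sum>n<N. norm (b (Suc n)) * p n) \<le> 2 * d * k * suminf p" for N
  proof -
    have "(\<Sum>n<N. norm (b (Suc n)) * p n)\<^sup>2
        = (\<Sum>n<N. (norm (b (Suc n)) * sqrt (p n)) * sqrt (p n))\<^sup>2"
      by (simp add: p0 mult.assoc)
    also have "\<dots> \<le> (\<Sum>n<N. (norm (b (Suc n)) * sqrt (p n))\<^sup>2) * (\<Sum>n<N. (sqrt (p n))\<^sup>2)"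
      by (rule Cauchy_Schwarz_ineq_sum)
    also have "\<dots> = (\<Sum>n<N. (norm (b (Suc n)))\<^sup>2 * p n) * (\<Sum>n<N. p n)"
      by (simp add: p0 power_mult_distrib)
    also have "\<dots> \<le> (2 * d * k)\<^sup>2 * (\<Sum>n<N. p n) * (\<Sum>n<N. p n)"
      by (intro mult_right_mono b_squares sum_nonneg p0)
    also have "\<dots> = (2 * d * k * (\<Sum>n<N. p n))\<^sup>2"
      by (simp add: power2_eq_square)
    finally have "(\<Sum>n<N. norm (b (Suc n)) * p n) \<le> 2 * d * k * (\<Sum>n<N. p n)"
      using d k p0 by (intro power2_le_imp_le[OF _ mult_nonneg_nonneg]) (auto intro: sum_nonneg)
    also have "\<dots> \<le> 2 * d * k * suminf p"
      using d k by (intro mult_left_mono p_le) auto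
    finally show ?thesis .
  qed
  have "summable (\<lambda>n. norm (a (Suc n)) * p n)"
    by (rule summableI_nonneg_bounded[OF _ a_part]) (simp add: p0)
  moreover from this have "(\<Sum>n. norm (a (Suc n)) * p n) \<le> 2 * d * suminf p"
    by (rule suminf_le_const) (rule a_part)
  moreover have "summable (\<lambda>n. norm (b (Suc n)) * p n)"
    by (rule summableI_nonneg_bounded[OF _ b_part]) (simp add: p0)
  moreover from this have "(\<Sum>n. norm (b (Suc n)) * p n) \<le> 2 * d * k * suminf p"
    by (rule suminf_le_const) (rule b_part)
  ultimately show "summable (\<lambda>n. norm (a (Suc n)) * \<phi> (Suc n) r)"
    and "summable (\<lambda>n. norm (b (Suc n)) * \<phi> (Suc n) r)"
    and "(\<Sum>n. norm (a (Suc n)) * \<phi> (Suc n) r) + (\<Sum>n. norm (b (Suc n)) * \<phi> (Suc n) r)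
           \<le> 2 * (1 + k) * Phi1 \<phi> r * boundary_dist \<psi>"
    by (simp_all add: p_def flip: Phi d_def) (simp add: algebra_simps)
qed

section \<open>The extremal half-plane map\<close>

text \<open>
  The map \<open>1 / (1 - z)\<close> has all coefficients equal to \<open>1\<close> and sends \<open>0\<close> to \<open>1\<close>, at distance \<open>1/2\<close> from
  the edge of its image. This is equality in the coefficient bound for subordinate functions, for every
  index at once.
\<close>

lemma half_plane_image:
  "(\<lambda>z. 1 / (1 - z)) ` ball 0 1 = {w. Re w > 1/2}"
proof (intro set_eqI iffI)
  \<comment> \<open>The preimage of \<open>w\<close> is \<open>(w - 1) / w\<close>. It lies in the disc iff \<open>w\<close> is nearer to \<open>1\<close> than to \<open>0\<close>.\<close>
  have key: "norm (w - 1) < norm w \<longleftrightarrow> Re w > 1/2" for w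
  proof -
    have "norm (w - 1) < norm w \<longleftrightarrow> (norm (w - 1))\<^sup>2 < (norm w)\<^sup>2"
      by (metis norm_ge_zero power2_less_imp_less power_strict_mono zero_less_numeral)
    also have "\<dots> \<longleftrightarrow> Re w > 1/2"
      unfolding cmod_power2 by (simp add: power2_eq_square algebra_simps)
    finally show ?thesis .
  qed
  fix w :: complex
  {
    assume "w \<in> (\<lambda>z. 1 / (1 - z)) ` ball 0 1"
    then obtain z where z: "norm z < 1" "w = 1 / (1 - z)" by auto
    then have "z \<noteq> 1" by auto
    then have "w - 1 = z * w" "w \<noteq> 0" using z by (auto simp: field_simps)
    then have "norm (w - 1) < norm w" using z(1) by (simp add: norm_mult)
    then show "w \<in> {w. Re w > 1/2}" using key by simp
  }
  assume "w \<in> {w. Re w > 1/2}"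
  then have w: "norm (w - 1) < norm w" using key by simp
  then have "w \<noteq> 0" by auto
  then have "w = 1 / (1 - (w - 1) / w)" by (simp add: field_simps)
  moreover have "norm ((w - 1) / w) < 1" using w \<open>w \<noteq> 0\<close> by (simp add: norm_divide)
  ultimately show "w \<in> (\<lambda>z. 1 / (1 - z)) ` ball 0 1" by (intro image_eqI) auto
qed

lemma half_plane_map_convex: "univalent_convex (\<lambda>z. 1 / (1 - z))"
  unfolding univalent_convex_def
proof (intro conjI)
  show "(\<lambda>z::complex. 1 / (1 - z)) holomorphic_on ball 0 1"
    by (intro holomorphic_intros) auto
  show "inj_on (\<lambda>z::complex. 1 / (1 - z)) (ball 0 1)"
    by (auto simp: inj_on_def)
  show "convex ((\<lambda>z::complex. 1 / (1 - z)) ` ball 0 1)"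
    unfolding half_plane_image by (rule convex_halfspace_Re_gt)
qed

lemma half_plane_boundary_dist: "boundary_dist (\<lambda>z. 1 / (1 - z)) \<le> 1 / 2"
proof -
  have "frontier {w::complex. Re w > 1/2} = {w. Re w = 1/2}"
    using frontier_halfspace_gt[of "1::complex" "1/2"] by (simp add: inner_complex_def)
  then have "1/2 \<in> frontier ((\<lambda>z::complex. 1 / (1 - z)) ` ball 0 1)"
    unfolding half_plane_image by simp
  then have "boundary_dist (\<lambda>z. 1 / (1 - z)) \<le> dist (1 / (1 - 0)) (1/2 :: complex)"
    unfolding boundary_dist_def by (rule infdist_le)
  then show ?thesis by (simp add: dist_norm)
qed

text \<open>
  Taking \<open>g = k (h - 1)\<close> gives equality in \<open>\<bar>g'\<bar> \<le> k \<bar>h'\<bar>\<close> throughout the disc, so all \<open>b\<^sub>n\<close> equal \<open>k\<close>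
  and the weighted sum is exactly \<open>(1 + k) \<Phi>\<^sub>1\<close>.
\<close>

lemma half_plane_mapping_admissible:
  assumes k: "0 \<le> k"
  shows "admissible k (\<lambda>z. 1 / (1 - z)) (\<lambda>z. 1 / (1 - z) + cnj (k * (z / (1 - z))))
    (\<lambda>z. 1 / (1 - z)) (\<lambda>z. k * (z / (1 - z))) (\<lambda>n. 1) (\<lambda>n. k)"
  unfolding admissible_def harmonic_decomp_def subordinate_def
proof (intro conjI ballI)
  show "(\<lambda>z::complex. 1 / (1 - z)) holomorphic_on ball 0 1"
    "(\<lambda>z::complex. k * (z / (1 - z))) holomorphic_on ball 0 1"
    by (intro holomorphic_intros; auto)+
  show "\<exists>\<omega>. \<omega> holomorphic_on ball 0 1 \<and> \<omega> 0 = 0 \<and>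
      (\<forall>z\<in>ball 0 1. norm (\<omega> z) < 1 \<and> 1 / (1 - z) = 1 / (1 - \<omega> z))"
    by (rule exI[of _ "\<lambda>z::complex. z"]) auto
  fix z :: complex assume "z \<in> ball 0 1"
  then have z: "norm z < 1" and "z \<noteq> 1" by auto
  show "(\<lambda>n. 1 * z ^ n) sums (1 / (1 - z))"
    using geometric_sums[OF z] by simp
  show "(\<lambda>n. complex_of_real k * z ^ Suc n) sums (k * (z / (1 - z)))"
    using sums_mult[OF geometric_sums[OF z], of "k * z"] by (simp add: mult.assoc)
  have "deriv (\<lambda>z. k * (z / (1 - z))) z = k * (1 / (1 - z)\<^sup>2)"
    using \<open>z \<noteq> 1\<close>
    by (intro DERIV_imp_deriv) (auto intro!: derivative_eq_intros simp: power2_eq_square field_simps)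
  moreover have "deriv (\<lambda>z. 1 / (1 - z)) z = 1 / (1 - z)\<^sup>2"
    using \<open>z \<noteq> 1\<close>
    by (intro DERIV_imp_deriv) (auto intro!: derivative_eq_intros simp: power2_eq_square field_simps)
  ultimately show "norm (deriv (\<lambda>z. k * (z / (1 - z))) z) \<le> k * norm (deriv (\<lambda>z. 1 / (1 - z)) z)"
    using k by (simp add: norm_mult norm_divide)
qed (rule half_plane_map_convex refl)+

section \<open>The sharp Bohr radius\<close>

theorem theorem5:
  fixes k R :: real and \<phi> :: "nat \<Rightarrow> real \<Rightarrow> real"
  assumes "0 \<le> k" and "k \<le> 1"
    and "\<phi> \<in> F_dec"
    and "0 < R" and "R < 1"
    and "1 = 2 * (1 + k) * Phi1 \<phi> R"
    and "\<forall>x\<in>{0<..<R}. 1 \<noteq> 2 * (1 + k) * Phi1 \<phi> x"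
    and "\<forall>r\<in>{0..<R}. 1 > 2 * (1 + k) * Phi1 \<phi> r"
  shows
    "(\<forall>\<psi> f h g a b. admissible k \<psi> f h g a b \<longrightarrow>
        (\<forall>r\<in>{0..R}.
           summable (\<lambda>n. norm (a (Suc n)) * \<phi> (Suc n) r) \<and>
           summable (\<lambda>n. norm (b (Suc n)) * \<phi> (Suc n) r) \<and>
           (\<Sum>n. norm (a (Suc n)) * \<phi> (Suc n) r) + (\<Sum>n. norm (b (Suc n)) * \<phi> (Suc n) r)
             \<le> boundary_dist \<psi>)) \<and>
     ((\<exists>\<epsilon>>0. {R<..<R + \<epsilon>} \<subseteq> {0<..<1} \<and>
          (\<forall>x\<in>{R<..<R + \<epsilon>}. 1 < 2 * (1 + k) * Phi1 \<phi> x)) \<longrightarrow>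
        (\<forall>R'\<in>{R<..<1}. \<exists>\<psi> f h g a b. admissible k \<psi> f h g a b \<and>
          (\<exists>r\<in>{R<..<R'}.
             summable (\<lambda>n. norm (a (Suc n)) * \<phi> (Suc n) r) \<and>
             summable (\<lambda>n. norm (b (Suc n)) * \<phi> (Suc n) r) \<and>
             (\<Sum>n. norm (a (Suc n)) * \<phi> (Suc n) r) + (\<Sum>n. norm (b (Suc n)) * \<phi> (Suc n) r)
               > boundary_dist \<psi>)))"
proof (intro conjI allI impI)
  fix \<psi> f h g a b assume adm: "admissible k \<psi> f h g a b"
  show "\<forall>r\<in>{0..R}.
           summable (\<lambda>n. norm (a (Suc n)) * \<phi> (Suc n) r) \<and>
           summable (\<lambda>n. norm (b (Suc n)) * \<phi> (Suc n) r) \<and>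
           (\<Sum>n. norm (a (Suc n)) * \<phi> (Suc n) r) + (\<Sum>n. norm (b (Suc n)) * \<phi> (Suc n) r)
             \<le> boundary_dist \<psi>"
  proof
    fix r assume r: "r \<in> {0..R}"
    then have r01: "0 \<le> r" "r < 1" using \<open>R < 1\<close> by auto
    have "2 * (1 + k) * Phi1 \<phi> r \<le> 1"
    proof (cases "r = R")
      case False
      then have "r \<in> {0..<R}" using r by auto
      then show ?thesis using assms(8) by (meson less_imp_le)
    qed (use assms(6) in simp)
    then have "2 * (1 + k) * Phi1 \<phi> r * boundary_dist \<psi> \<le> 1 * boundary_dist \<psi>"
      by (intro mult_right_mono) (simp_all add: boundary_dist_def infdist_nonneg)
    then show "summable (\<lambda>n. norm (a (Suc n)) * \<phi> (Suc n) r) \<and>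
           summable (\<lambda>n. norm (b (Suc n)) * \<phi> (Suc n) r) \<and>
           (\<Sum>n. norm (a (Suc n)) * \<phi> (Suc n) r) + (\<Sum>n. norm (b (Suc n)) * \<phi> (Suc n) r)
             \<le> boundary_dist \<psi>"
      using weighted_coeff_sum_bound[OF adm assms(1,3) r01] by linarith
  qed
next
  assume "\<exists>\<epsilon>>0. {R<..<R + \<epsilon>} \<subseteq> {0<..<1} \<and>
          (\<forall>x\<in>{R<..<R + \<epsilon>}. 1 < 2 * (1 + k) * Phi1 \<phi> x)"
  then obtain \<epsilon> where \<epsilon>: "\<epsilon> > 0" "\<And>x. x \<in> {R<..<R + \<epsilon>} \<Longrightarrow> 1 < 2 * (1 + k) * Phi1 \<phi> x"
    by blast
  show "\<forall>R'\<in>{R<..<1}. \<exists>\<psi> f h g a b. admissible k \<psi> f h g a b \<and>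
          (\<exists>r\<in>{R<..<R'}.
             summable (\<lambda>n. norm (a (Suc n)) * \<phi> (Suc n) r) \<and>
             summable (\<lambda>n. norm (b (Suc n)) * \<phi> (Suc n) r) \<and>
             (\<Sum>n. norm (a (Suc n)) * \<phi> (Suc n) r) + (\<Sum>n. norm (b (Suc n)) * \<phi> (Suc n) r)
               > boundary_dist \<psi>)"
  proof
    fix R' assume R': "R' \<in> {R<..<1}"
    obtain r where r: "R < r" "r < min (R + \<epsilon>) R'"
      using dense[of R "min (R + \<epsilon>) R'"] R' \<epsilon>(1) by auto
    have "summable (\<lambda>n. \<phi> (Suc n) r)"
      using assms(3,4) r R' by (intro F_class_summable) (auto simp: F_dec_def)
    then have sums: "summable (\<lambda>n. norm (1::complex) * \<phi> (Suc n) r)"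
      "summable (\<lambda>n. norm (complex_of_real k) * \<phi> (Suc n) r)"
      "(\<Sum>n. norm (1::complex) * \<phi> (Suc n) r) + (\<Sum>n. norm (complex_of_real k) * \<phi> (Suc n) r)
        = (1 + k) * Phi1 \<phi> r"
      using assms(1) by (simp_all add: summable_mult suminf_mult Phi1_def algebra_simps)
    have "1 < 2 * (1 + k) * Phi1 \<phi> r"
      using \<epsilon>(2) r by simp
    then have "boundary_dist (\<lambda>z. 1 / (1 - z)) < (1 + k) * Phi1 \<phi> r"
      using half_plane_boundary_dist by linarith
    moreover have "r \<in> {R<..<R'}" using r by simp
    ultimately show "\<exists>\<psi> f h g a b. admissible k \<psi> f h g a b \<and>
          (\<exists>r\<in>{R<..<R'}.
             summable (\<lambda>n. norm (a (Suc n)) * \<phi> (Suc n) r) \<and>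
             summable (\<lambda>n. norm (b (Suc n)) * \<phi> (Suc n) r) \<and>
             (\<Sum>n. norm (a (Suc n)) * \<phi> (Suc n) r) + (\<Sum>n. norm (b (Suc n)) * \<phi> (Suc n) r)
               > boundary_dist \<psi>)"
      using half_plane_mapping_admissible[OF assms(1)] sums by fastforce
  qed
qed

end
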